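(* Let $G$ be a finite non-abelian nilpotent group, let $p_1,\dots,p_t$ be the distinct prime divisors of $|G|$, and for each $i\in\{1,\dots,t\}$ let $P_i$ be a Sylow $p_i$-subgroup of $G$. Then $$\gamma\bigl(\mathcal{C}^{**}(G)\bigr)=\min_{\substack{1\le i\le t\\ P_i\text{ non-abelian}}}\gamma\bigl(\mathcal{C}^{**}(P_i)\bigr).$$
   Context: For a finite group $G$ with center $Z(G)$, the proper commuting graph $\mathcal{C}^{**}(G)$ is the simple graph with vertex set $G\setminus Z(G)$ in which two distinct vertices $x,y$ are adjacent if and only if $xy=yx$. A dominating set of a finite simple graph with vertex set $V$ is a subset $X\subseteq V$ such that every vertex of $V\setminus X$ is adjacent to some vertex of $X$; the domination number $\gamma$ is the minimum cardinality of a dominating set. *)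

theory Defs
  imports "HOL-Algebra.Generated_Groups" "HOL-Algebra.Sylow" "Graph_Theory.Pair_Digraph"
begin

section \<open>Groups\<close>

definition center :: "('a, 'b) monoid_scheme \<Rightarrow> 'a set" where
  "center G = {z \<in> carrier G. \<forall>g \<in> carrier G. z \<otimes>\<^bsub>G\<^esub> g = g \<otimes>\<^bsub>G\<^esub> z}"

definition commutator_subgroup :: "('a, 'b) monoid_scheme \<Rightarrow> 'a set \<Rightarrow> 'a set \<Rightarrow> 'a set" where
  "commutator_subgroup G H K = generate G
     (\<Union>h \<in> H. \<Union>k \<in> K. {h \<otimes>\<^bsub>G\<^esub> k \<otimes>\<^bsub>G\<^esub> inv\<^bsub>G\<^esub> h \<otimes>\<^bsub>G\<^esub> inv\<^bsub>G\<^esub> k})"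

lemma commutator_subgroup_self: "commutator_subgroup G H H = derived G H"
  by (simp add: commutator_subgroup_def derived_def)

text \<open>Indexed from 0: the term with index 0 is the whole group.\<close>

primrec lower_central_series :: "('a, 'b) monoid_scheme \<Rightarrow> nat \<Rightarrow> 'a set" where
  "lower_central_series G 0 = carrier G"
| "lower_central_series G (Suc n) =
     commutator_subgroup G (lower_central_series G n) (carrier G)"

definition nilpotent_group :: "('a, 'b) monoid_scheme \<Rightarrow> bool" where
  "nilpotent_group G \<longleftrightarrow> group G \<and> (\<exists>n. lower_central_series G n = {\<one>\<^bsub>G\<^esub>})"

text \<open>Meant for finite \<open>G\<close>: \<open>p ^ multiplicity p (order G)\<close> is the largest power of \<open>p\<close>
  dividing the order.\<close>

definition sylow_subgroup :: "nat \<Rightarrow> 'a set \<Rightarrow> ('a, 'b) monoid_scheme \<Rightarrow> bool" where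
  "sylow_subgroup p P G \<longleftrightarrow>
     Factorial_Ring.prime p \<and> subgroup P G \<and> card P = p ^ multiplicity p (order G)"


section \<open>Domination and the proper commuting graph\<close>

text \<open>As in \<open>Graph_Theory\<close>, a simple graph is a finite loop-free symmetric digraph without
  multiple arcs.\<close>

definition dominating_set :: "('a, 'b) pre_digraph \<Rightarrow> 'a set \<Rightarrow> bool" where
  "dominating_set \<Gamma> X \<longleftrightarrow>
     X \<subseteq> verts \<Gamma> \<and> (\<forall>v \<in> verts \<Gamma> - X. \<exists>x \<in> X. v \<rightarrow>\<^bsub>\<Gamma>\<^esub> x)"

definition domination_number :: "('a, 'b) pre_digraph \<Rightarrow> nat" where
  "domination_number \<Gamma> = Min (card ` {X. dominating_set \<Gamma> X})"

definition proper_commuting_graph :: "('a, 'b) monoid_scheme \<Rightarrow> 'a pair_pre_digraph" where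
  "proper_commuting_graph G =
     \<lparr> pverts = carrier G - center G,
       parcs = {(x, y). x \<in> carrier G - center G \<and> y \<in> carrier G - center G \<and>
                  x \<noteq> y \<and> x \<otimes>\<^bsub>G\<^esub> y = y \<otimes>\<^bsub>G\<^esub> x} \<rparr>"

lemma pair_graph_proper_commuting_graph:
  assumes "finite (carrier G)"
  shows "pair_graph (proper_commuting_graph G)"
proof -
  have "parcs (proper_commuting_graph G) \<subseteq> carrier G \<times> carrier G"
    by (auto simp: proper_commuting_graph_def)
  then have fin: "finite (parcs (proper_commuting_graph G))"
    using assms finite_subset by blast
  show ?thesis
  proof
    show "finite (parcs (proper_commuting_graph G))" by (rule fin)
    show "symmetric (with_proj (proper_commuting_graph G))"
      by (auto simp: proper_commuting_graph_def symmetric_def intro!: symI)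
  qed (use assms in \<open>auto simp: proper_commuting_graph_def\<close>)
qed

end

theory Submission
  imports Defs "HOL-Algebra.Multiplicative_Group" "HOL-Number_Theory.Cong"
begin

text \<open>
  A finite nilpotent group is the internal direct product of its Sylow subgroups \<open>P i\<close>, and two of
  its elements commute if and only if all their components do. The whole argument rests on this.

  For the upper bound, a dominating set of one non-abelian \<open>P i\<close> already dominates \<open>G\<close>: an element
  of \<open>P i\<close> commutes with \<open>g\<close> as soon as it commutes with the \<open>i\<close>-th component of \<open>g\<close>, and this
  component is either central in \<open>P i\<close> or dominated there (\<open>dominating_set_sylow_imp\<close>).

  For the lower bound, let \<open>X\<close> dominate \<open>G\<close>. If for every non-abelian \<open>P i\<close> the non-central
  \<open>i\<close>-th components of the elements of \<open>X\<close> failed to dominate \<open>P i\<close>, there would be a non-central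
  \<open>f i\<close> in each such \<open>P i\<close> commuting with none of them. The element \<open>g\<close> with these components is
  non-central, hence commutes with some \<open>x\<close> in \<open>X\<close>; but \<open>x\<close> has a non-central component, and that
  component would commute with the matching \<open>f i\<close>. So the components of \<open>X\<close> dominate some \<open>P i\<close>,
  and there are at most \<open>card X\<close> of them (\<open>dominating_set_imp_sylow\<close>).

  The product decomposition comes from one fact on nilpotent groups: elements annihilated by coprime
  exponents commute (\<open>coprime_order_commute\<close>), because their commutator slides down the lower
  central series. Thus different Sylow subgroups centralize each other; they generate \<open>G\<close> by
  Lagrange's theorem, so each is normal, and so contains every element of \<open>p i\<close>-power order. The
  \<open>i\<close>-th component can then be described without products over \<open>I\<close>: it is the power \<open>g [^] e\<close>, where
  \<open>e\<close> is \<open>1\<close> modulo \<open>card (P i)\<close> and \<open>0\<close> modulo \<open>order G div card (P i)\<close>. Being a power of \<open>g\<close>,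
  it commutes with everything that \<open>g\<close> commutes with.
\<close>

section \<open>Elements of coprime order in nilpotent groups\<close>

lemma (in group) mem_subgroup_of_coprime_powers:
  fixes m n :: nat
  assumes "subgroup H G" "x \<in> carrier G" "coprime m n" "x [^] m \<in> H" "x [^] n \<in> H"
  shows "x \<in> H"
proof -
  obtain u v where uv: "u * int m + v * int n = 1"
    using assms(3) bezout_int[of "int m" "int n"] by auto
  have "x = x [^] (int m * u + int n * v)"
    using uv assms(2) by (simp add: mult.commute)
  also have "\<dots> = (x [^] m) [^] u \<otimes> (x [^] n) [^] v"
    using assms(2) by (simp add: int_pow_mult int_pow_int flip: int_pow_pow)
  also have "\<dots> \<in> H"
    using assms by (simp add: group.int_pow_closed subgroup_int_pow_closed subgroup.m_closed)
  finally show ?thesis .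
qed

lemma (in group) pow_eq_one_of_dvd:
  fixes k m :: nat
  assumes "x \<in> carrier G" "x [^] m = \<one>" "m dvd k"
  shows "x [^] k = \<one>"
  using pow_eq_id[OF assms(1)] assms(2,3) dvd_trans[of "ord x" m k] by simp

lemma (in group) pow_cong:
  fixes k l m :: nat
  assumes "x \<in> carrier G" "x [^] m = \<one>" "[k = l] (mod m)"
  shows "x [^] k = x [^] l"
proof -
  have "x [^] k = x [^] (k mod m)" for k
  proof -
    have "x [^] k = x [^] (m * (k div m) + k mod m)" by simp
    also have "\<dots> = x [^] (m * (k div m)) \<otimes> x [^] (k mod m)"
      using assms(1) by (intro nat_pow_mult[symmetric])
    also have "x [^] (m * (k div m)) = \<one>"
      by (rule pow_eq_one_of_dvd[OF assms(1,2)]) simp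
    finally show ?thesis using assms(1) by simp
  qed
  from this[of k] this[of l] show ?thesis using assms(3) by (simp add: cong_def)
qed

lemma (in group) commute_inv:
  assumes "x \<in> carrier G" "y \<in> carrier G" "x \<otimes> y = y \<otimes> x"
  shows "inv x \<otimes> y = y \<otimes> inv x"
  by (metis assms inv_closed inv_solve_left inv_solve_right m_assoc m_closed)

lemma (in group) commute_mult:
  assumes "x \<in> carrier G" "y \<in> carrier G" "z \<in> carrier G"
    "x \<otimes> z = z \<otimes> x" "y \<otimes> z = z \<otimes> y"
  shows "(x \<otimes> y) \<otimes> z = z \<otimes> (x \<otimes> y)"
  using assms by (metis m_assoc)

text \<open>Moving \<open>y\<close> past each factor of \<open>x [^] m\<close> costs one factor \<open>c\<close>, so a trivial \<open>x [^] m\<close>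
  leaves \<open>y = c [^] m \<otimes> y\<close>.\<close>

lemma (in group) centralizing_multiplier_pow:
  fixes m :: nat
  assumes "x \<in> carrier G" "y \<in> carrier G" "c \<in> carrier G"
    and xy: "x \<otimes> y = c \<otimes> y \<otimes> x" and cx: "c \<otimes> x = x \<otimes> c" and "x [^] m = \<one>"
  shows "c [^] m = \<one>"
proof -
  have "x [^] k \<otimes> y = c [^] k \<otimes> y \<otimes> x [^] k" for k :: nat
  proof (induction k)
    case (Suc k)
    have "x [^] Suc k \<otimes> y = x [^] k \<otimes> (c \<otimes> y \<otimes> x)"
      using assms by (simp add: m_assoc)
    also have "\<dots> = c \<otimes> (x [^] k \<otimes> y) \<otimes> x"
      using assms group_commutes_pow[OF cx[symmetric], of k]
      by (simp flip: m_assoc)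
    also have "\<dots> = c [^] Suc k \<otimes> y \<otimes> x [^] Suc k"
      using assms nat_pow_Suc2 by (simp add: Suc m_assoc)
    finally show ?case .
  qed (use assms in simp)
  from this[of m] show ?thesis using assms
    by (metis l_cancel_one' nat_pow_closed r_one l_one m_closed r_cancel_one)
qed

lemma (in group) card_subgroup_dvd:
  assumes "subgroup H G" "subgroup K G" "H \<subseteq> K"
  shows "card H dvd card K"
proof -
  interpret K: group "G\<lparr>carrier := K\<rparr>" using assms(2) by (rule subgroup_imp_group)
  have "card (rcosets\<^bsub>G\<lparr>carrier := K\<rparr>\<^esub> H) * card H = card K"
    using K.lagrange[OF subgroup_incl[OF assms]] by (simp add: order_def)
  then show ?thesis by (metis dvd_triv_right)
qed

lemma (in group) lower_central_series_normal: "lower_central_series G n \<lhd> G"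
proof (induction n)
  case 0 show ?case by (simp add: normal_self)
next
  case (Suc n)
  let ?L = "lower_central_series G n"
  let ?C = "\<Union>h\<in>?L. \<Union>k\<in>carrier G. {h \<otimes> k \<otimes> inv h \<otimes> inv k}"
  have L: "?L \<subseteq> carrier G"
    using Suc normal_imp_subgroup subgroup.subset by blast
  have "generate G ?C \<lhd> G"
  proof (rule normal_generateI)
    show "?C \<subseteq> carrier G" using L by auto
  next
    fix z g assume "z \<in> ?C" and g: "g \<in> carrier G"
    then obtain h k where h: "h \<in> ?L" and k: "k \<in> carrier G"
      and z: "z = h \<otimes> k \<otimes> inv h \<otimes> inv k" by auto
    have hc: "h \<in> carrier G" using h L by auto
    let ?h = "g \<otimes> h \<otimes> inv g" and ?k = "g \<otimes> k \<otimes> inv g"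
    have cancel: "inv g \<otimes> (g \<otimes> w) = w" if "w \<in> carrier G" for w
      using that g by (simp flip: m_assoc)
    have "g \<otimes> z \<otimes> inv g = ?h \<otimes> ?k \<otimes> inv ?h \<otimes> inv ?k"
      using g hc k by (simp add: z inv_mult_group m_assoc cancel)
    moreover have "?h \<in> ?L" using Suc h g by (simp add: normal_invE(2))
    moreover have "?k \<in> carrier G" using g k by simp
    ultimately show "g \<otimes> z \<otimes> inv g \<in> ?C" by blast
  qed
  then show ?case by (simp add: commutator_subgroup_def)
qed

text \<open>In \<open>G Mod H\<close> the coset of \<open>c\<close> is central, and it is the commutator of the cosets of \<open>x\<close> and
  \<open>y\<close>. So the exponent \<open>m\<close> of \<open>x\<close> annihilates it. The exponent \<open>n\<close> of \<open>y\<close> does so too, by the same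
  argument with \<open>x\<close> and \<open>y\<close> exchanged, which replaces \<open>c\<close> by its inverse.\<close>

lemma (in normal) central_multiplier_mem:
  fixes m n :: nat
  assumes x: "x \<in> carrier G" and y: "y \<in> carrier G" and c: "c \<in> carrier G"
    and xy: "x \<otimes> y = c \<otimes> y \<otimes> x"
    and central: "\<And>g. g \<in> carrier G \<Longrightarrow> c \<otimes> g \<otimes> inv c \<otimes> inv g \<in> H"
    and "coprime m n" and xm: "x [^] m = \<one>" and yn: "y [^] n = \<one>"
  shows "c \<in> H"
proof -
  interpret Q: group "G Mod H" by (rule factorgroup_is_group)
  interpret q: group_hom G "G Mod H" "\<lambda>a. H #> a"
    by unfold_locales (rule r_coset_hom_Mod)
  have hom: "H #> (a \<otimes> b) = (H #> a) \<otimes>\<^bsub>G Mod H\<^esub> (H #> b)"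
    if "a \<in> carrier G" "b \<in> carrier G" for a b
    using that by (rule q.hom_mult)
  note closed = q.hom_closed[OF x] q.hom_closed[OF y] q.hom_closed[OF c]
    q.hom_closed[OF inv_closed[OF c]]
  have comm: "(H #> c) \<otimes>\<^bsub>G Mod H\<^esub> (H #> g) = (H #> g) \<otimes>\<^bsub>G Mod H\<^esub> (H #> c)"
    if g: "g \<in> carrier G" for g
  proof -
    have "H #> (c \<otimes> g \<otimes> inv c \<otimes> inv g) = \<one>\<^bsub>G Mod H\<^esub>"
      using rcos_const[OF is_group central[OF g]] by simp
    moreover have "c \<otimes> g = (c \<otimes> g \<otimes> inv c \<otimes> inv g) \<otimes> (g \<otimes> c)"
    proof -
      have "inv g \<otimes> (g \<otimes> c) = c" using c g by (simp flip: m_assoc)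
      then show ?thesis using c g by (simp add: m_assoc)
    qed
    ultimately have "H #> (c \<otimes> g) = \<one>\<^bsub>G Mod H\<^esub> \<otimes>\<^bsub>G Mod H\<^esub> (H #> (g \<otimes> c))"
      using c g hom by (metis inv_closed m_closed)
    also have "\<dots> = H #> (g \<otimes> c)"
      by (rule Q.l_one) (use c g q.hom_closed in blast)
    finally show ?thesis using c g hom by metis
  qed
  have pow_mem: "a [^] k \<in> H" if "a \<in> carrier G" "(H #> a) [^]\<^bsub>G Mod H\<^esub> k = \<one>\<^bsub>G Mod H\<^esub>"
    for a and k :: nat
    using that coset_join1[OF _ nat_pow_closed subgroup_axioms] FactGroup_pow[of a k] by simp
  have pow_one: "(H #> a) [^]\<^bsub>G Mod H\<^esub> k = \<one>\<^bsub>G Mod H\<^esub>" if "a \<in> carrier G" "a [^] k = \<one>"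
    for a and k :: nat
    using that FactGroup_pow[of a k] q.hom_one by metis
  have yx: "y \<otimes> x = inv c \<otimes> x \<otimes> y"
  proof -
    have "inv c \<otimes> (c \<otimes> (y \<otimes> x)) = y \<otimes> x"
      using c x y by (simp flip: m_assoc)
    then show ?thesis using xy c x y by (simp add: m_assoc)
  qed
  have "c [^] m \<in> H"
  proof (rule pow_mem[OF c Q.centralizing_multiplier_pow[OF closed(1,2,3)]])
    show "(H #> x) \<otimes>\<^bsub>G Mod H\<^esub> (H #> y) = (H #> c) \<otimes>\<^bsub>G Mod H\<^esub> (H #> y) \<otimes>\<^bsub>G Mod H\<^esub> (H #> x)"
      using xy c x y hom by (metis m_closed)
  qed (rule comm[OF x] pow_one[OF x xm])+
  moreover have "c [^] n \<in> H"
  proof -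
    have "inv c [^] n \<in> H"
    proof (rule pow_mem[OF inv_closed[OF c] Q.centralizing_multiplier_pow[OF closed(2,1,4)]])
      show "(H #> y) \<otimes>\<^bsub>G Mod H\<^esub> (H #> x)
          = (H #> inv c) \<otimes>\<^bsub>G Mod H\<^esub> (H #> x) \<otimes>\<^bsub>G Mod H\<^esub> (H #> y)"
        using yx c x y hom by (metis m_closed inv_closed)
      show "(H #> inv c) \<otimes>\<^bsub>G Mod H\<^esub> (H #> y) = (H #> y) \<otimes>\<^bsub>G Mod H\<^esub> (H #> inv c)"
        using Q.commute_inv[OF closed(3,2) comm[OF y]] q.hom_inv[OF c] by simp
    qed (rule pow_one[OF y yn])
    then have "inv (inv c [^] n) \<in> H" by (rule m_inv_closed)
    then show ?thesis using c by (simp add: nat_pow_inv)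
  qed
  ultimately show ?thesis
    using mem_subgroup_of_coprime_powers[OF subgroup_axioms c assms(6)] by blast
qed

text \<open>If the commutator of \<open>x\<close> and \<open>y\<close> lies in one term of the lower central series, it is central
  modulo the next term, and \<open>central_multiplier_mem\<close> puts it into that term. It therefore lies in
  every term, hence is trivial.\<close>

lemma (in group) coprime_order_commute:
  fixes m n :: nat
  assumes "nilpotent_group G" "x \<in> carrier G" "y \<in> carrier G"
    and "coprime m n" "x [^] m = \<one>" "y [^] n = \<one>"
  shows "x \<otimes> y = y \<otimes> x"
proof -
  define c where "c = x \<otimes> y \<otimes> inv x \<otimes> inv y"
  have c: "c \<in> carrier G" using assms by (simp add: c_def)
  have xy: "x \<otimes> y = c \<otimes> y \<otimes> x" using assms by (simp add: c_def m_assoc)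
  have "c \<in> lower_central_series G k" for k
  proof (induction k)
    case 0 show ?case using c by simp
  next
    case (Suc k)
    show ?case
    proof (rule normal.central_multiplier_mem[OF lower_central_series_normal
          assms(2,3) c xy _ assms(4-6)])
      fix g assume "g \<in> carrier G"
      then show "c \<otimes> g \<otimes> inv c \<otimes> inv g \<in> lower_central_series G (Suc k)"
        using Suc by (auto simp: commutator_subgroup_def intro!: generate.incl)
    qed
  qed
  then have "c = \<one>" using assms(1) by (auto simp: nilpotent_group_def)
  then show ?thesis using xy assms by simp
qed

section \<open>The Sylow decomposition\<close>

locale nilpotent_sylow_family = group G for G (structure) +
  fixes I :: "'i set" and p :: "'i \<Rightarrow> nat" and P :: "'i \<Rightarrow> 'a set"
  assumes finite: "finite (carrier G)"
    and nilpotent: "nilpotent_group G"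
    and primes: "bij_betw p I {q. Factorial_Ring.prime q \<and> q dvd order G}"
    and sylow: "i \<in> I \<Longrightarrow> sylow_subgroup (p i) (P i) G"
begin

lemma order_pos: "order G > 0"
  using finite by (simp add: order_gt_0_iff_finite)

lemma finite_index: "finite I"
proof -
  have "finite {q. q dvd order G}" using order_pos by simp
  then have "finite {q. Factorial_Ring.prime q \<and> q dvd order G}"
    by (rule rev_finite_subset) auto
  then show ?thesis using primes bij_betw_finite by blast
qed

lemma sylow_subgroup: "i \<in> I \<Longrightarrow> subgroup (P i) G"
  using sylow by (simp add: sylow_subgroup_def)

lemma sylow_in_carrier: "i \<in> I \<Longrightarrow> x \<in> P i \<Longrightarrow> x \<in> carrier G"
  using sylow_subgroup subgroup.mem_carrier by metis

lemma prime_index: "i \<in> I \<Longrightarrow> Factorial_Ring.prime (p i)"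
  using sylow by (simp add: sylow_subgroup_def)

lemma card_sylow: "i \<in> I \<Longrightarrow> card (P i) = p i ^ multiplicity (p i) (order G)"
  using sylow by (simp add: sylow_subgroup_def)

lemma card_sylow_dvd: "i \<in> I \<Longrightarrow> card (P i) dvd order G"
  by (simp add: card_sylow multiplicity_dvd)

lemma coprime_sylow_index:
  assumes "i \<in> I" shows "coprime (card (P i)) (order G div card (P i))"
proof -
  have "\<not> is_unit (p i)" "order G \<noteq> 0"
    using prime_index[OF assms] order_pos not_prime_unit by auto
  then have "\<not> p i dvd order G div card (P i)"
    using multiplicity_decompose[of "order G" "p i"] card_sylow[OF assms] by simp
  then show ?thesis
    using prime_index[OF assms] by (simp add: card_sylow[OF assms] prime_imp_coprime)
qed

lemma coprime_sylow_cards: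
  assumes "i \<in> I" "j \<in> I" "i \<noteq> j"
  shows "coprime (card (P i)) (card (P j))"
proof -
  have "p i \<noteq> p j" using assms primes by (auto simp: bij_betw_def inj_on_def)
  then show ?thesis using assms prime_index by (simp add: card_sylow primes_coprime)
qed

lemma card_sylow_dvd_index:
  assumes "i \<in> I" "j \<in> I" "i \<noteq> j"
  shows "card (P j) dvd order G div card (P i)"
proof -
  have "order G = card (P i) * (order G div card (P i))"
    using card_sylow_dvd assms(1) by simp
  then show ?thesis
    using card_sylow_dvd[OF assms(2)] coprime_sylow_cards[OF assms]
    by (metis coprime_commute coprime_dvd_mult_right_iff)
qed

lemma sylow_pow_card:
  assumes "i \<in> I" "x \<in> P i" shows "x [^] card (P i) = \<one>"
proof -
  interpret S: group "G\<lparr>carrier := P i\<rparr>"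
    using assms sylow_subgroup subgroup_imp_group by blast
  show ?thesis
    using S.pow_order_eq_1[of x] assms by (simp add: order_def flip: nat_pow_consistent)
qed

lemma sylow_commute:
  assumes "i \<in> I" "j \<in> I" "i \<noteq> j" "x \<in> P i" "y \<in> P j"
  shows "x \<otimes> y = y \<otimes> x"
  by (rule coprime_order_commute[OF nilpotent sylow_in_carrier[OF assms(1,4)]
        sylow_in_carrier[OF assms(2,5)] coprime_sylow_cards[OF assms(1-3)]
        sylow_pow_card[OF assms(1,4)] sylow_pow_card[OF assms(2,5)]])

text \<open>The order of the generated subgroup is divisible by each \<open>card (P i)\<close>, that is, by the full power
  of every prime that divides \<open>order G\<close>.\<close>

lemma generate_sylow: "generate G (\<Union>i\<in>I. P i) = carrier G"
proof -
  define H where "H = generate G (\<Union>i\<in>I. P i)"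
  have "(\<Union>i\<in>I. P i) \<subseteq> carrier G" using sylow_in_carrier by auto
  then have H: "subgroup H G" unfolding H_def by (rule generate_is_subgroup)
  have sub: "H \<subseteq> carrier G" using H by (rule subgroup.subset)
  then have fin: "finite H" using finite by (rule finite_subset)
  have pos: "card H > 0" using fin subgroup.one_closed[OF H] by (auto simp: card_gt_0_iff)
  have card_dvd: "card (P i) dvd card H" if i: "i \<in> I" for i
  proof (rule card_subgroup_dvd[OF sylow_subgroup[OF i] H])
    show "P i \<subseteq> H" using i generate.incl[of _ "\<Union>i\<in>I. P i" G] by (auto simp: H_def)
  qed
  have "order G dvd card H"
  proof (rule multiplicity_le_imp_dvd)
    fix q :: nat assume q: "Factorial_Ring.prime q"
    show "multiplicity q (order G) \<le> multiplicity q (card H)"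
    proof (cases "q dvd order G")
      case True
      then have "q \<in> p ` I" using q bij_betw_imp_surj_on[OF primes] by simp
      then obtain i where i: "i \<in> I" "p i = q" by blast
      have "q ^ multiplicity q (order G) dvd card H"
        using card_dvd[OF i(1)] card_sylow[OF i(1)] i(2) by simp
      then show ?thesis
        using q pos by (intro multiplicity_geI) (auto dest: not_prime_unit)
    qed (simp add: not_dvd_imp_multiplicity_0)
  qed (use order_pos in simp)
  then have "card (carrier G) \<le> card H"
    using pos by (simp add: order_def dvd_imp_le)
  then show ?thesis using card_seteq[OF finite sub] by (simp add: H_def)
qed

lemma carrier_sylow_induct [consumes 1, case_names one sylow mult]:
  assumes "g \<in> carrier G" "Q \<one>"
    and "\<And>i x. i \<in> I \<Longrightarrow> x \<in> P i \<Longrightarrow> Q x"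
    and "\<And>x y. x \<in> carrier G \<Longrightarrow> y \<in> carrier G \<Longrightarrow> Q x \<Longrightarrow> Q y \<Longrightarrow> Q (x \<otimes> y)"
  shows "Q g"
proof -
  have "g \<in> generate G (\<Union>i\<in>I. P i)" using assms(1) generate_sylow by simp
  then have "g \<in> carrier G \<and> Q g"
  proof induction
    case one
    show ?case using assms(2) by simp
  next
    case (incl h)
    then obtain i where i: "i \<in> I" "h \<in> P i" by blast
    show ?case using assms(3)[OF i] sylow_in_carrier[OF i] by simp
  next
    case (inv h)
    then obtain i where i: "i \<in> I" "h \<in> P i" by blast
    then have inv: "inv h \<in> P i" using subgroup.m_inv_closed[OF sylow_subgroup] by simp
    show ?case using assms(3)[OF i(1) inv] sylow_in_carrier[OF i(1) inv] by simp
  next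
    case (eng x y)
    then show ?case using assms(4)[of x y] by simp
  qed
  then show ?thesis ..
qed

text \<open>It suffices to conjugate by the generators: those in \<open>P i\<close> preserve \<open>P i\<close>, and those in another
  \<open>P j\<close> centralize it.\<close>

lemma sylow_normal:
  assumes i: "i \<in> I" shows "P i \<lhd> G"
proof (rule normal_invI)
  show S: "subgroup (P i) G" using i by (rule sylow_subgroup)
  fix g h assume "g \<in> carrier G" "h \<in> P i"
  then show "g \<otimes> h \<otimes> inv g \<in> P i"
  proof (induction g arbitrary: h rule: carrier_sylow_induct)
    case one
    then show ?case using sylow_in_carrier[OF i] by simp
  next
    case (sylow j x)
    have h: "h \<in> carrier G" using i sylow.prems by (rule sylow_in_carrier)
    have x: "x \<in> carrier G" using sylow.hyps by (rule sylow_in_carrier)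
    show ?case
    proof (cases "j = i")
      case True
      then have "x \<in> P i" using sylow.hyps by simp
      then show ?thesis
        using sylow.prems subgroup.m_closed[OF S] subgroup.m_inv_closed[OF S] by simp
    next
      case False
      have "x \<otimes> h = h \<otimes> x"
        by (rule sylow_commute[OF sylow.hyps(1) i False sylow.hyps(2) sylow.prems])
      then have "x \<otimes> h \<otimes> inv x = h" using x h by (simp add: m_assoc)
      then show ?thesis using sylow.prems by simp
    qed
  next
    case (mult x y)
    have h: "h \<in> carrier G" using i mult.prems by (rule sylow_in_carrier)
    have "x \<otimes> y \<otimes> h \<otimes> inv (x \<otimes> y) = x \<otimes> (y \<otimes> h \<otimes> inv y) \<otimes> inv x"
      using mult.hyps h by (simp add: inv_mult_group m_assoc)
    also have "\<dots> \<in> P i" using mult.IH mult.prems by blast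
    finally show ?case .
  qed
qed

text \<open>The quotient by \<open>P i\<close> has order prime to \<open>card (P i)\<close>, so an element annihilated by
  \<open>card (P i)\<close> becomes trivial there.\<close>

lemma sylow_memI:
  assumes i: "i \<in> I" and x: "x \<in> carrier G" "x [^] card (P i) = \<one>"
  shows "x \<in> P i"
proof -
  interpret N: normal "P i" G using i by (rule sylow_normal)
  interpret Q: group "G Mod P i" by (rule N.factorgroup_is_group)
  have "order G = order (G Mod P i) * card (P i)"
    using lagrange[OF N.subgroup_axioms] by (simp add: FactGroup_def order_def)
  then have ord: "order (G Mod P i) = order G div card (P i)"
    using order_pos by (metis mult_is_0 nonzero_mult_div_cancel_right not_gr_zero)
  have "P i #> (x [^] order (G Mod P i)) = P i"
    using Q.pow_order_eq_1[of "P i #> x"] x N.FactGroup_pow[of x]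
    by (simp add: carrier_FactGroup)
  then have "x [^] (order G div card (P i)) \<in> P i"
    using x coset_join1[OF _ _ N.subgroup_axioms] unfolding ord by simp
  moreover have "x [^] card (P i) \<in> P i" using x N.one_closed by simp
  ultimately show ?thesis
    using mem_subgroup_of_coprime_powers[OF N.subgroup_axioms x(1) coprime_sylow_index[OF i]]
    by blast
qed

definition projection_exponent :: "'i \<Rightarrow> nat" where
  "projection_exponent i =
     (SOME e. [e = 1] (mod card (P i)) \<and> [e = 0] (mod (order G div card (P i))))"

text \<open>The \<open>i\<close>-th component of \<open>g\<close> in the direct product of the Sylow subgroups.\<close>

definition sylow_part :: "'i \<Rightarrow> 'a \<Rightarrow> 'a" where
  "sylow_part i g = g [^] projection_exponent i"

lemma projection_exponent:
  assumes "i \<in> I"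
  shows "[projection_exponent i = 1] (mod card (P i))"
    and "order G div card (P i) dvd projection_exponent i"
  using someI_ex[OF binary_chinese_remainder_nat[OF coprime_sylow_index[OF assms], of 1 0]]
  by (simp_all add: projection_exponent_def cong_0_iff)

lemma sylow_part_closed: "g \<in> carrier G \<Longrightarrow> sylow_part i g \<in> carrier G"
  by (simp add: sylow_part_def)

lemma sylow_part_one: "sylow_part i \<one> = \<one>"
  by (simp add: sylow_part_def)

lemma sylow_part_mem:
  assumes "i \<in> I" "g \<in> carrier G"
  shows "sylow_part i g \<in> P i"
proof (rule sylow_memI)
  have "order G dvd projection_exponent i * card (P i)"
    using projection_exponent(2)[OF assms(1)] card_sylow_dvd[OF assms(1)]
      mult_dvd_mono[of "order G div card (P i)" "projection_exponent i" "card (P i)" "card (P i)"]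
    by simp
  then show "sylow_part i g [^] card (P i) = \<one>"
    using pow_eq_one_of_dvd[OF assms(2) pow_order_eq_1] assms(2)
    by (simp add: sylow_part_def nat_pow_pow)
qed (use assms sylow_part_closed in simp_all)

lemma sylow_part_self:
  assumes "i \<in> I" "x \<in> P i" shows "sylow_part i x = x"
  using pow_cong[OF sylow_in_carrier[OF assms] sylow_pow_card[OF assms]
      projection_exponent(1)[OF assms(1)]] sylow_in_carrier[OF assms]
  by (simp add: sylow_part_def)

lemma sylow_part_other:
  assumes "i \<in> I" "j \<in> I" "i \<noteq> j" "x \<in> P j" shows "sylow_part i x = \<one>"
proof -
  have "card (P j) dvd projection_exponent i"
    using card_sylow_dvd_index[OF assms(1-3)] projection_exponent(2)[OF assms(1)] dvd_trans by blast
  then show ?thesis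
    using pow_eq_one_of_dvd[OF sylow_in_carrier[OF assms(2,4)] sylow_pow_card[OF assms(2,4)]]
    by (simp add: sylow_part_def)
qed

lemma sylow_part_mult:
  assumes "g \<in> carrier G" "h \<in> carrier G" "g \<otimes> h = h \<otimes> g"
  shows "sylow_part i (g \<otimes> h) = sylow_part i g \<otimes> sylow_part i h"
  using pow_mult_distrib[OF assms(3,1,2)] by (simp add: sylow_part_def)

lemma commute_sylow_part:
  assumes "g \<in> carrier G" "h \<in> carrier G" "g \<otimes> h = h \<otimes> g"
  shows "sylow_part i g \<otimes> h = h \<otimes> sylow_part i g"
  using assms by (simp add: sylow_part_def group_commutes_pow)

text \<open>The complementary factor \<open>g \<otimes> inv (sylow_part i g)\<close> has order prime to \<open>card (P i)\<close>, so it
  centralizes \<open>P i\<close> by nilpotency, and only the component matters.\<close>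

lemma commute_iff_sylow_part:
  assumes i: "i \<in> I" and h: "h \<in> P i" and g: "g \<in> carrier G"
  shows "g \<otimes> h = h \<otimes> g \<longleftrightarrow> sylow_part i g \<otimes> h = h \<otimes> sylow_part i g"
proof
  have hc: "h \<in> carrier G" using i h by (rule sylow_in_carrier)
  show "sylow_part i g \<otimes> h = h \<otimes> sylow_part i g" if "g \<otimes> h = h \<otimes> g"
    using commute_sylow_part g hc that by blast
  assume part: "sylow_part i g \<otimes> h = h \<otimes> sylow_part i g"
  let ?u = "sylow_part i g" and ?m = "order G div card (P i)"
  have u: "?u \<in> carrier G" using g by (rule sylow_part_closed)
  define v where "v = g \<otimes> inv ?u"
  have v: "v \<in> carrier G" "g = v \<otimes> ?u" using g u by (simp_all add: v_def m_assoc)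
  have "g [^] (order G) = \<one>" using g by (rule pow_order_eq_1)
  moreover have "[projection_exponent i * ?m = ?m] (mod order G)"
  proof -
    have "[projection_exponent i * ?m = 1 * ?m] (mod (card (P i) * ?m))"
      using projection_exponent(1)[OF i] unfolding cong_def by (metis mult_mod_left)
    then show ?thesis using card_sylow_dvd[OF i] by simp
  qed
  ultimately have "?u [^] ?m = g [^] ?m"
    using pow_cong[OF g] g by (simp add: sylow_part_def nat_pow_pow)
  moreover have "inv ?u \<otimes> g = g \<otimes> inv ?u"
    using commute_sylow_part[OF g g] u g commute_inv by blast
  ultimately have "v [^] ?m = \<one>"
    using g u by (simp add: v_def pow_mult_distrib nat_pow_inv)
  then have "v \<otimes> h = h \<otimes> v"
    using coprime_order_commute[OF nilpotent v(1) hc, of ?m "card (P i)"]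
      coprime_sylow_index[OF i] sylow_pow_card[OF i h] by (simp add: coprime_commute)
  then show "g \<otimes> h = h \<otimes> g"
    using part commute_mult[OF v(1) u hc] v(2) by simp
qed

text \<open>The element is built by multiplying in one prescribed component at a time. The
  new factor in \<open>P j\<close> commutes with the product so far, whose \<open>j\<close>-th component is still trivial, so
  \<open>sylow_part_mult\<close> applies.\<close>

lemma exists_sylow_parts:
  assumes "\<And>i. i \<in> I \<Longrightarrow> f i \<in> P i"
  shows "\<exists>g\<in>carrier G. \<forall>i\<in>I. sylow_part i g = f i"
proof -
  have "\<exists>g\<in>carrier G. \<forall>i\<in>I. sylow_part i g = (if i \<in> S then f i else \<one>)"
    if "finite S" "S \<subseteq> I" for S
    using that
  proof (induction S rule: finite_induct)
    case empty
    show ?case using sylow_part_one by auto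
  next
    case (insert j S)
    then obtain g where g: "g \<in> carrier G"
      and parts: "\<And>i. i \<in> I \<Longrightarrow> sylow_part i g = (if i \<in> S then f i else \<one>)"
      by auto
    have j: "j \<in> I" and fj: "f j \<in> P j" "f j \<in> carrier G"
      using insert.prems assms sylow_in_carrier by auto
    have "g \<otimes> f j = f j \<otimes> g"
      using commute_iff_sylow_part[OF j fj(1) g] parts[OF j] insert.hyps fj by simp
    then have mult: "sylow_part i (g \<otimes> f j) = sylow_part i g \<otimes> sylow_part i (f j)" for i
      by (rule sylow_part_mult[OF g fj(2)])
    have "sylow_part i (g \<otimes> f j) = (if i \<in> insert j S then f i else \<one>)" if i: "i \<in> I" for i
    proof (cases "i = j")
      case True
      then show ?thesis
        using mult[of i] parts[OF i] insert.hyps fj sylow_part_self[OF j fj(1)] by simp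
    next
      case False
      then show ?thesis
        using mult[of i] parts[OF i] sylow_in_carrier[OF i assms[OF i]]
          sylow_part_other[OF i j False fj(1)] by simp
    qed
    then show ?case using g fj by blast
  qed
  from this[OF finite_index] show ?thesis by simp
qed

lemma center_iff_sylow_parts:
  assumes g: "g \<in> carrier G"
  shows "g \<in> center G \<longleftrightarrow> (\<forall>i\<in>I. sylow_part i g \<in> center (G\<lparr>carrier := P i\<rparr>))"
proof
  assume "g \<in> center G"
  then show "\<forall>i\<in>I. sylow_part i g \<in> center (G\<lparr>carrier := P i\<rparr>)"
    using g sylow_part_mem commute_sylow_part sylow_in_carrier by (auto simp: center_def)
next
  assume parts: "\<forall>i\<in>I. sylow_part i g \<in> center (G\<lparr>carrier := P i\<rparr>)"
  have "h \<otimes> g = g \<otimes> h" if "h \<in> carrier G" for h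
    using that
  proof (induction rule: carrier_sylow_induct)
    case (sylow i x)
    then show ?case using parts commute_iff_sylow_part[of i x g] g by (auto simp: center_def)
  next
    case (mult x y)
    then show ?case using commute_mult[OF _ _ g] by blast
  qed (use g in simp)
  then show "g \<in> center G" using g by (auto simp: center_def)
qed

end

section \<open>Domination\<close>

text \<open>Every vertex commutes with itself, so quantifying over all vertices, including those in \<open>X\<close>,
  expresses domination without adjacency.\<close>

lemma dominating_set_proper_commuting_graph:
  "dominating_set (with_proj (proper_commuting_graph G)) X \<longleftrightarrow>
     X \<subseteq> carrier G - center G \<and>
     (\<forall>v\<in>carrier G - center G. \<exists>x\<in>X. v \<otimes>\<^bsub>G\<^esub> x = x \<otimes>\<^bsub>G\<^esub> v)"
  (is "?L \<longleftrightarrow> ?R")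
proof -
  let ?\<Gamma> = "with_proj (proper_commuting_graph G)"
  have verts: "verts ?\<Gamma> = carrier G - center G"
    by (simp add: proper_commuting_graph_def)
  have adj: "v \<rightarrow>\<^bsub>?\<Gamma>\<^esub> x \<longleftrightarrow> v \<noteq> x \<and> v \<otimes>\<^bsub>G\<^esub> x = x \<otimes>\<^bsub>G\<^esub> v"
    if "v \<in> carrier G - center G" "x \<in> carrier G - center G" for v x
    using that by (simp add: proper_commuting_graph_def)
  show ?thesis
    unfolding dominating_set_def verts
  proof (intro conj_cong refl iffI ballI)
    fix v assume X: "X \<subseteq> carrier G - center G" and v: "v \<in> carrier G - center G"
      and dom: "\<forall>v\<in>carrier G - center G - X. \<exists>x\<in>X. v \<rightarrow>\<^bsub>?\<Gamma>\<^esub> x"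
    show "\<exists>x\<in>X. v \<otimes>\<^bsub>G\<^esub> x = x \<otimes>\<^bsub>G\<^esub> v"
    proof (cases "v \<in> X")
      case False
      then obtain x where "x \<in> X" "v \<rightarrow>\<^bsub>?\<Gamma>\<^esub> x" using dom v by blast
      then show ?thesis using adj[OF v] X by blast
    qed blast
  next
    fix v assume X: "X \<subseteq> carrier G - center G" and v: "v \<in> carrier G - center G - X"
      and dom: "\<forall>v\<in>carrier G - center G. \<exists>x\<in>X. v \<otimes>\<^bsub>G\<^esub> x = x \<otimes>\<^bsub>G\<^esub> v"
    obtain x where x: "x \<in> X" "v \<otimes>\<^bsub>G\<^esub> x = x \<otimes>\<^bsub>G\<^esub> v" using dom v by blast
    then have "v \<rightarrow>\<^bsub>?\<Gamma>\<^esub> x" using adj[of v x] X v by blast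
    then show "\<exists>x\<in>X. v \<rightarrow>\<^bsub>?\<Gamma>\<^esub> x" using x(1) by blast
  qed
qed

lemma domination_number_le:
  assumes "finite (verts \<Gamma>)" "dominating_set \<Gamma> X"
  shows "domination_number \<Gamma> \<le> card X"
proof -
  have "finite {X. dominating_set \<Gamma> X}"
    by (rule finite_subset[of _ "Pow (verts \<Gamma>)"]) (use assms in \<open>auto simp: dominating_set_def\<close>)
  then show ?thesis using assms by (auto simp: domination_number_def)
qed

lemma domination_number_attained:
  assumes "finite (verts \<Gamma>)"
  obtains X where "dominating_set \<Gamma> X" "card X = domination_number \<Gamma>"
proof -
  have "finite {X. dominating_set \<Gamma> X}"
    by (rule finite_subset[of _ "Pow (verts \<Gamma>)"]) (use assms in \<open>auto simp: dominating_set_def\<close>)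
  moreover have "dominating_set \<Gamma> (verts \<Gamma>)" by (simp add: dominating_set_def)
  ultimately have "domination_number \<Gamma> \<in> card ` {X. dominating_set \<Gamma> X}"
    unfolding domination_number_def by (intro Min_in) auto
  then show ?thesis using that by auto
qed

lemma (in group) comm_group_iff_center: "comm_group G \<longleftrightarrow> center G = carrier G"
proof
  assume "comm_group G"
  then interpret comm_group G .
  show "center G = carrier G" by (auto simp: center_def m_comm)
next
  assume "center G = carrier G"
  then show "comm_group G" by (intro group_comm_groupI) (auto simp: center_def)
qed

context nilpotent_sylow_family
begin

lemma comm_group_sylow_iff:
  "i \<in> I \<Longrightarrow> comm_group (G\<lparr>carrier := P i\<rparr>) \<longleftrightarrow> center (G\<lparr>carrier := P i\<rparr>) = P i"
  using group.comm_group_iff_center[OF subgroup_imp_group[OF sylow_subgroup]] by simp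

lemma comm_group_iff_sylow: "comm_group G \<longleftrightarrow> (\<forall>i\<in>I. comm_group (G\<lparr>carrier := P i\<rparr>))"
proof
  assume "comm_group G"
  then interpret comm_group G .
  show "\<forall>i\<in>I. comm_group (G\<lparr>carrier := P i\<rparr>)"
  proof
    fix i assume i: "i \<in> I"
    show "comm_group (G\<lparr>carrier := P i\<rparr>)"
      using group.group_comm_groupI[OF subgroup_imp_group[OF sylow_subgroup[OF i]]]
        m_comm sylow_in_carrier[OF i] by simp
  qed
next
  assume R: "\<forall>i\<in>I. comm_group (G\<lparr>carrier := P i\<rparr>)"
  have "g \<in> center G" if "g \<in> carrier G" for g
    using center_iff_sylow_parts[OF that] R that sylow_part_mem comm_group_sylow_iff by auto
  then show "comm_group G" unfolding comm_group_iff_center by (auto simp: center_def)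
qed

text \<open>Non-commutativity of \<open>P i\<close> makes \<open>X\<close> nonempty; any of its elements then serves for those \<open>v\<close>
  whose \<open>i\<close>-th component is central in \<open>P i\<close>.\<close>

lemma dominating_set_sylow_imp:
  assumes i: "i \<in> I" and nab: "\<not> comm_group (G\<lparr>carrier := P i\<rparr>)"
    and X: "dominating_set (proper_commuting_graph (G\<lparr>carrier := P i\<rparr>)) X"
  shows "dominating_set (proper_commuting_graph G) X"
proof -
  let ?S = "G\<lparr>carrier := P i\<rparr>"
  have XP: "X \<subseteq> P i - center ?S"
    and dom: "\<And>v. v \<in> P i - center ?S \<Longrightarrow> \<exists>x\<in>X. v \<otimes> x = x \<otimes> v"
    using X unfolding dominating_set_proper_commuting_graph by auto
  have "center ?S \<noteq> P i" using nab comm_group_sylow_iff[OF i] by simp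
  then have "\<exists>w. w \<in> P i - center ?S" by (auto simp: center_def)
  then obtain x0 where x0: "x0 \<in> X" using dom by blast
  have "X \<subseteq> carrier G - center G"
  proof
    fix x assume "x \<in> X"
    then have x: "x \<in> P i" "x \<notin> center ?S" using XP by auto
    then have xG: "x \<in> carrier G" using i sylow_in_carrier by simp
    then show "x \<in> carrier G - center G"
      using i x sylow_part_self[OF i x(1)] center_iff_sylow_parts[OF xG] by auto
  qed
  moreover have "\<exists>x\<in>X. v \<otimes> x = x \<otimes> v" if v: "v \<in> carrier G" for v
  proof -
    have mem: "sylow_part i v \<in> P i" using i v by (rule sylow_part_mem)
    obtain x where x: "x \<in> X" "sylow_part i v \<otimes> x = x \<otimes> sylow_part i v"
    proof (cases "sylow_part i v \<in> center ?S")
      case True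
      then show ?thesis using that x0 XP by (auto simp: center_def)
    next
      case False
      then show ?thesis using that dom mem by blast
    qed
    then have "v \<otimes> x = x \<otimes> v" using commute_iff_sylow_part[OF i _ v] XP by blast
    then show ?thesis using x by blast
  qed
  ultimately show ?thesis unfolding dominating_set_proper_commuting_graph by auto
qed

text \<open>Central components are discarded because they are no vertices of the graph of \<open>P i\<close>. If the
  remaining ones dominated no non-abelian \<open>P i\<close>, undominated witnesses for all \<open>i\<close> at once would be
  the components of a single element of \<open>G\<close> that \<open>X\<close> does not dominate.\<close>

lemma dominating_set_imp_sylow:
  assumes nab: "\<not> comm_group G" and X: "dominating_set (proper_commuting_graph G) X"
  shows "\<exists>i\<in>I. \<not> comm_group (G\<lparr>carrier := P i\<rparr>) \<and>
    dominating_set (proper_commuting_graph (G\<lparr>carrier := P i\<rparr>))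
      (sylow_part i ` X - center (G\<lparr>carrier := P i\<rparr>))"
proof (rule ccontr)
  let ?Z = "\<lambda>i. center (G\<lparr>carrier := P i\<rparr>)"
  assume contra: "\<not> ?thesis"
  have XG: "X \<subseteq> carrier G - center G"
    and dom: "\<And>v. v \<in> carrier G - center G \<Longrightarrow> \<exists>x\<in>X. v \<otimes> x = x \<otimes> v"
    using X unfolding dominating_set_proper_commuting_graph by auto
  \<comment> \<open>For abelian \<open>P i\<close> no vertex exists and \<open>\<one>\<close> is an admissible choice of \<open>w\<close>.\<close>
  have "\<exists>w. w \<in> P i \<and> (P i \<noteq> ?Z i \<longrightarrow> w \<notin> ?Z i) \<and>
      (\<forall>x\<in>X. sylow_part i x \<notin> ?Z i \<longrightarrow> w \<otimes> sylow_part i x \<noteq> sylow_part i x \<otimes> w)"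
    if i: "i \<in> I" for i
  proof (cases "P i = ?Z i")
    case True
    then have "sylow_part i x \<in> ?Z i" if "x \<in> X" for x
      using sylow_part_mem[OF i] that XG by blast
    then show ?thesis using True subgroup.one_closed[OF sylow_subgroup[OF i]] by blast
  next
    case False
    then have "\<not> dominating_set (proper_commuting_graph (G\<lparr>carrier := P i\<rparr>)) (sylow_part i ` X - ?Z i)"
      using contra i comm_group_sylow_iff by auto
    moreover have "sylow_part i ` X - ?Z i \<subseteq> P i - ?Z i"
      using sylow_part_mem[OF i] XG by blast
    ultimately show ?thesis unfolding dominating_set_proper_commuting_graph by auto
  qed
  then obtain f where f: "\<And>i. i \<in> I \<Longrightarrow> f i \<in> P i"
    and f_noncentral: "\<And>i. i \<in> I \<Longrightarrow> P i \<noteq> ?Z i \<Longrightarrow> f i \<notin> ?Z i"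
    and f_avoids: "\<And>i x. i \<in> I \<Longrightarrow> x \<in> X \<Longrightarrow> sylow_part i x \<notin> ?Z i \<Longrightarrow>
      f i \<otimes> sylow_part i x \<noteq> sylow_part i x \<otimes> f i"
    by metis
  obtain g where g: "g \<in> carrier G" and parts: "\<And>i. i \<in> I \<Longrightarrow> sylow_part i g = f i"
    using exists_sylow_parts[of f] f by auto
  obtain k where "k \<in> I" "P k \<noteq> ?Z k"
    using nab comm_group_iff_sylow comm_group_sylow_iff by auto
  then have "g \<notin> center G"
    using center_iff_sylow_parts[OF g] parts f_noncentral by auto
  then obtain x where x: "x \<in> X" "g \<otimes> x = x \<otimes> g" using dom g by auto
  have xc: "x \<in> carrier G" "x \<notin> center G" using x XG by auto
  then obtain i where i: "i \<in> I" "sylow_part i x \<notin> ?Z i"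
    using center_iff_sylow_parts by auto
  have "f i \<otimes> x = x \<otimes> f i"
    using commute_sylow_part[OF g xc(1) x(2), of i] parts[OF i(1)] by simp
  then have "sylow_part i x \<otimes> f i = f i \<otimes> sylow_part i x"
    using commute_sylow_part[OF xc(1), of "f i" i] f i(1) sylow_in_carrier by metis
  then show False using f_avoids[OF i(1) x(1) i(2)] by simp
qed

theorem domination_number_eq_Min:
  assumes nab: "\<not> comm_group G"
  shows "domination_number (proper_commuting_graph G) =
    Min ((\<lambda>i. domination_number (proper_commuting_graph (G\<lparr>carrier := P i\<rparr>))) `
      {i \<in> I. \<not> comm_group (G\<lparr>carrier := P i\<rparr>)})"
proof (rule sym, rule Min_eqI)
  let ?\<gamma> = "\<lambda>i. domination_number (proper_commuting_graph (G\<lparr>carrier := P i\<rparr>))"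
  let ?J = "{i \<in> I. \<not> comm_group (G\<lparr>carrier := P i\<rparr>)}"
  have fin: "finite (verts (proper_commuting_graph G))"
    using finite by (simp add: proper_commuting_graph_def)
  have fin_sylow: "finite (verts (proper_commuting_graph (G\<lparr>carrier := P i\<rparr>)))" if "i \<in> I" for i
    using finite_subset[OF subgroup.subset[OF sylow_subgroup[OF that]] finite]
    by (simp add: proper_commuting_graph_def)
  show "finite (?\<gamma> ` ?J)" using finite_index by simp
  have le: "domination_number (proper_commuting_graph G) \<le> ?\<gamma> i" if "i \<in> ?J" for i
  proof -
    have i: "i \<in> I" "\<not> comm_group (G\<lparr>carrier := P i\<rparr>)" using that by simp_all
    obtain Y where Y: "dominating_set (proper_commuting_graph (G\<lparr>carrier := P i\<rparr>)) Y"
      "card Y = ?\<gamma> i"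
      by (rule domination_number_attained[OF fin_sylow[OF i(1)]])
    show ?thesis
      using domination_number_le[OF fin dominating_set_sylow_imp[OF i Y(1)]] Y(2) by simp
  qed
  then show "domination_number (proper_commuting_graph G) \<le> y" if "y \<in> ?\<gamma> ` ?J" for y
    using that by auto
  obtain X where X: "dominating_set (proper_commuting_graph G) X"
    "card X = domination_number (proper_commuting_graph G)"
    by (rule domination_number_attained[OF fin])
  then have fin_X: "finite X" using fin finite_subset by (auto simp: dominating_set_def)
  obtain i where i: "i \<in> ?J"
    and dom: "dominating_set (proper_commuting_graph (G\<lparr>carrier := P i\<rparr>))
      (sylow_part i ` X - center (G\<lparr>carrier := P i\<rparr>))"
    using dominating_set_imp_sylow[OF nab X(1)] by auto
  have "?\<gamma> i \<le> card (sylow_part i ` X - center (G\<lparr>carrier := P i\<rparr>))"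
    using domination_number_le[OF fin_sylow dom] i by simp
  also have "\<dots> \<le> card (sylow_part i ` X)" using fin_X by (intro card_mono) auto
  also have "\<dots> \<le> card X" using fin_X by (rule card_image_le)
  finally have "?\<gamma> i = domination_number (proper_commuting_graph G)"
    using le[OF i] X(2) by simp
  then show "domination_number (proper_commuting_graph G) \<in> ?\<gamma> ` ?J"
    by (intro image_eqI[OF _ i]) simp
qed

end

theorem theorem4p5:
  fixes G :: "('a, 'b) monoid_scheme"
    and t :: nat
    and p :: "nat \<Rightarrow> nat"
    and P :: "nat \<Rightarrow> 'a set"
  assumes "group G"
    and "finite (carrier G)"
    and "\<not> comm_group G"
    and "nilpotent_group G"
    and "bij_betw p {1..t} {q. Factorial_Ring.prime q \<and> q dvd order G}"
    and "\<And>i. i \<in> {1..t} \<Longrightarrow> sylow_subgroup (p i) (P i) G"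
  shows "domination_number (proper_commuting_graph G) =
    Min ((\<lambda>i. domination_number (proper_commuting_graph (G\<lparr>carrier := P i\<rparr>))) `
      {i \<in> {1..t}. \<not> comm_group (G\<lparr>carrier := P i\<rparr>)})"
proof -
  interpret nilpotent_sylow_family G "{1..t}" p P
    by (rule nilpotent_sylow_family.intro[OF assms(1)
          nilpotent_sylow_family_axioms.intro[OF assms(2,4,5,6)]])
  show ?thesis using assms(3) by (rule domination_number_eq_Min)
qed

end
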